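(* Let $d,k\ge 1$, let $H_0\in\mathbb{R}^{d\times d}$ be symmetric, and let $s_i,y_i,v_i\in\mathbb{R}^d$ ($0\le i\le k-1$) satisfy $v_i^Ty_i\ne 0$ for all $i$. Let $H_k$ be the matrix given by either of the following two equivalent representations: $$H_k=H_0+\begin{bmatrix}V_k & S_k-H_0Y_k\end{bmatrix}M_k^{-1}\begin{bmatrix}V_k^T\\ (S_k-H_0Y_k)^T\end{bmatrix},$$ $$H_k=H_0+\begin{bmatrix}V_k & S_k & H_0Y_k\end{bmatrix}\begin{bmatrix} M_k^{-1} & \begin{bmatrix}-(R_k^{VY})^{-T}\\ 0_{k\times k}\end{bmatrix}\\[2mm] \begin{bmatrix}-(R_k^{VY})^{-1} & 0_{k\times k}\end{bmatrix} & 0_{k\times k}\end{bmatrix}\begin{bmatrix}V_k^T\\ S_k^T\\ Y_k^TH_0\end{bmatrix}.$$ If $V_k=S_k$ (that is, $v_i=s_i$ for all $i$), then $H_k$ reduces to the compact BFGS formula $$H_k=H_0+\begin{bmatrix}S_k & H_0Y_k\end{bmatrix}\begin{bmatrix}R_k^{-T}(D_k+Y_k^TH_0Y_k)R_k^{-1} & -R_k^{-T}\\ -R_k^{-1} & 0_{k\times k}\end{bmatrix}\begin{bmatrix}S_k^T\\ Y_k^TH_0\end{bmatrix}.$$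
   Context: $S_k=[s_0\ \cdots\ s_{k-1}]$, $Y_k=[y_0\ \cdots\ y_{k-1}]$, $V_k=[v_0\ \cdots\ v_{k-1}]$ are the $d\times k$ matrices with the indicated columns. With rows and columns indexed by $0,\dots,k-1$: $D_k$ is the $k\times k$ diagonal matrix with $(D_k)_{ii}=s_i^Ty_i$; $R_k$ is the upper triangular part (including the diagonal) of $S_k^TY_k$; $R_k^{VY}$ is the upper triangular part (including the diagonal) of $V_k^TY_k$. $M_k^{-1}$ is the inverse of $$M_k=\begin{bmatrix}0_{k\times k} & R_k^{VY}\\ (R_k^{VY})^T & R_k+R_k^T-(D_k+Y_k^TH_0Y_k)\end{bmatrix}.$$ $A^{-T}$ denotes $(A^{-1})^T$. *)

theory Defs
  imports "Jordan_Normal_Form.Gauss_Jordan_Elimination"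
begin

definition append_cols :: "'a :: zero mat \<Rightarrow> 'a mat \<Rightarrow> 'a mat" (infixr \<open>@\<^sub>c\<close> 65) where
  "A @\<^sub>c B = four_block_mat A B (0\<^sub>m 0 (dim_col A)) (0\<^sub>m 0 (dim_col B))"

text \<open>
  The value for non-invertible arguments is unspecified, so a claim that mentions this inverse
  should also assert invertibility.
\<close>

definition minv :: "'a :: field mat \<Rightarrow> 'a mat" where
  "minv A = the (mat_inverse A)"

definition upper_part :: "'a :: zero mat \<Rightarrow> 'a mat" where
  "upper_part A = mat (dim_row A) (dim_col A) (\<lambda>(i, j). if i \<le> j then A $$ (i, j) else 0)"

text \<open>
  Throughout, \<open>d\<close> is the dimension of the ambient space, and only the values of the vector sequences
  \<open>s\<close>, \<open>y\<close>, \<open>v\<close> at indices below \<open>k\<close> matter.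
\<close>

definition cols_mat :: "nat \<Rightarrow> nat \<Rightarrow> (nat \<Rightarrow> real vec) \<Rightarrow> real mat" where
  "cols_mat d k x = mat_of_cols d (map x [0..<k])"

definition D_mat :: "nat \<Rightarrow> (nat \<Rightarrow> real vec) \<Rightarrow> (nat \<Rightarrow> real vec) \<Rightarrow> real mat" where
  "D_mat k s y = mat_diag k (\<lambda>i. s i \<bullet> y i)"

text \<open>\<open>R_mat d k s y\<close> is $R_k$, and \<open>R_mat d k v y\<close> is $R_k^{VY}$.\<close>

definition R_mat :: "nat \<Rightarrow> nat \<Rightarrow> (nat \<Rightarrow> real vec) \<Rightarrow> (nat \<Rightarrow> real vec) \<Rightarrow> real mat" where
  "R_mat d k x y = upper_part (transpose_mat (cols_mat d k x) * cols_mat d k y)"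

definition M_mat ::
  "nat \<Rightarrow> nat \<Rightarrow> real mat \<Rightarrow> (nat \<Rightarrow> real vec) \<Rightarrow> (nat \<Rightarrow> real vec) \<Rightarrow> (nat \<Rightarrow> real vec) \<Rightarrow> real mat" where
  "M_mat d k H0 s y v =
    (let Y = cols_mat d k y; R = R_mat d k s y; RVY = R_mat d k v y in
     four_block_mat
       (0\<^sub>m k k)             RVY
       (transpose_mat RVY)  (R + transpose_mat R - (D_mat k s y + transpose_mat Y * H0 * Y)))"

definition H_compact1 ::
  "nat \<Rightarrow> nat \<Rightarrow> real mat \<Rightarrow> (nat \<Rightarrow> real vec) \<Rightarrow> (nat \<Rightarrow> real vec) \<Rightarrow> (nat \<Rightarrow> real vec) \<Rightarrow> real mat" where
  "H_compact1 d k H0 s y v =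
    (let S = cols_mat d k s; Y = cols_mat d k y; V = cols_mat d k v in
     H0 + (V @\<^sub>c (S - H0 * Y)) * minv (M_mat d k H0 s y v)
          * (transpose_mat V @\<^sub>r transpose_mat (S - H0 * Y)))"

definition H_compact2 ::
  "nat \<Rightarrow> nat \<Rightarrow> real mat \<Rightarrow> (nat \<Rightarrow> real vec) \<Rightarrow> (nat \<Rightarrow> real vec) \<Rightarrow> (nat \<Rightarrow> real vec) \<Rightarrow> real mat" where
  "H_compact2 d k H0 s y v =
    (let S = cols_mat d k s; Y = cols_mat d k y; V = cols_mat d k v; RVY = R_mat d k v y in
     H0 + (V @\<^sub>c S @\<^sub>c (H0 * Y))
          * four_block_mat
              (minv (M_mat d k H0 s y v))  (- transpose_mat (minv RVY) @\<^sub>r 0\<^sub>m k k)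
              (- minv RVY @\<^sub>c 0\<^sub>m k k)     (0\<^sub>m k k)
          * (transpose_mat V @\<^sub>r transpose_mat S @\<^sub>r (transpose_mat Y * H0)))"

definition H_BFGS ::
  "nat \<Rightarrow> nat \<Rightarrow> real mat \<Rightarrow> (nat \<Rightarrow> real vec) \<Rightarrow> (nat \<Rightarrow> real vec) \<Rightarrow> real mat" where
  "H_BFGS d k H0 s y =
    (let S = cols_mat d k s; Y = cols_mat d k y; R = R_mat d k s y in
     H0 + (S @\<^sub>c (H0 * Y))
          * four_block_mat
              (transpose_mat (minv R) * (D_mat k s y + transpose_mat Y * H0 * Y) * minv R)
              (- transpose_mat (minv R))
              (- minv R)
              (0\<^sub>m k k)
          * (transpose_mat S @\<^sub>r (transpose_mat Y * H0)))"

end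

theory Submission
  imports Defs "Jordan_Normal_Form.Determinant"
begin

text \<open>
  Write $R = R_k^{VY}$, $P = R^{-1}$, $G = H_0 Y_k$, $Q = D_k + Y_k^T G$ and
  $N = R_k + R_k^T - Q$. The diagonal entries of the triangular matrix $R$ are the nonzero numbers
  $v_i^T y_i$, so $P$ exists (\<open>det_R_mat_nonzero\<close>). Since the upper left block of $M_k$ vanishes,
  its inverse is explicit (\<open>minv_zero_corner_block\<close>):
  $$M_k^{-1} = \begin{bmatrix} -P^T N P & P^T \cr P & 0 \end{bmatrix}.$$
  After substitution every formula is $H_0$ plus a sum of monomials in
  $V_k, S_k, G, P, N, Q$ and their transposes.

  The two representations agree because the off-diagonal blocks $P^T$ and $P$ of $M_k^{-1}$ pair
  $V_k$ with $(S_k - G)^T = S_k^T - G^T$. In the second one, the part with $S_k$ comes from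
  $M_k^{-1}$ and the part with $-G$ from the additional blocks $-P^T$ and $-P$
  (\<open>three_block_formula_eq_two_block\<close>). The symmetry of $H_0$ enters through
  $Y_k^T H_0 = G^T$.

  If $V_k = S_k$, then $R = R_k$ is also the triangular matrix inside $N$, and
  $-P^T N P = P^T Q P - P^T - P$ (\<open>congruence_cancels_triangular_parts\<close>). The terms
  $-S_k P^T S_k^T$ and $-S_k P S_k^T$ which this produces cancel exactly the contributions of
  the $S_k$ part of $S_k - G$, and what remains is the BFGS formula
  (\<open>two_block_formula_eq_BFGS_form\<close>).
\<close>

section \<open>Matrix algebra with shape side conditions\<close>

text \<open>
  The shape conditions are equations between dimensions rather than membership in
  \<open>carrier_mat\<close>: the latter leaves free dimension variables that the simplifier would have to
  guess, whereas these conditions it can compute from the factors.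
\<close>

lemma mat_mult_assoc_dim:
  fixes A B C :: "'a :: semiring_0 mat"
  assumes "dim_col A = dim_row B" "dim_col B = dim_row C"
  shows "A * B * C = A * (B * C)"
  using assms by (intro assoc_mult_mat) auto

lemma mat_distrib_dim:
  fixes A B C :: "'a :: ring mat"
  shows "dim_row A = dim_row B \<Longrightarrow> dim_col A = dim_col B \<Longrightarrow> dim_col B = dim_row C \<Longrightarrow>
      (A + B) * C = A * C + B * C"
    and "dim_row A = dim_row B \<Longrightarrow> dim_col A = dim_col B \<Longrightarrow> dim_col B = dim_row C \<Longrightarrow>
      (A - B) * C = A * C - B * C"
    and "dim_col A = dim_row B \<Longrightarrow> dim_row B = dim_row C \<Longrightarrow> dim_col B = dim_col C \<Longrightarrow>
      A * (B + C) = A * B + A * C"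
    and "dim_col A = dim_row B \<Longrightarrow> dim_row B = dim_row C \<Longrightarrow> dim_col B = dim_col C \<Longrightarrow>
      A * (B - C) = A * B - A * C"
  by (rule add_mult_distrib_mat minus_mult_distrib_mat mult_add_distrib_mat
      mult_minus_distrib_mat; auto)+

lemmas mat_ring_simps = mat_mult_assoc_dim mat_distrib_dim

section \<open>Products of block matrices\<close>

lemma append_cols_carrier [simp, intro]:
  assumes "A \<in> carrier_mat n p" "B \<in> carrier_mat n q"
  shows "A @\<^sub>c B \<in> carrier_mat n (p + q)"
  using assms unfolding append_cols_def by auto

lemma append_cols_assoc:
  assumes "A \<in> carrier_mat n p" "B \<in> carrier_mat n q" "C \<in> carrier_mat n r"
  shows "(A @\<^sub>c B) @\<^sub>c C = A @\<^sub>c B @\<^sub>c C"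
  using assms unfolding append_cols_def by (intro eq_matI) auto

lemma append_rows_assoc:
  assumes "A \<in> carrier_mat p n" "B \<in> carrier_mat q n" "C \<in> carrier_mat r n"
  shows "(A @\<^sub>r B) @\<^sub>r C = A @\<^sub>r B @\<^sub>r C"
  using assms unfolding append_rows_def by (intro eq_matI) auto

lemma append_cols_mult_append_rows:
  fixes A B C D :: "'a :: ring mat"
  assumes "A \<in> carrier_mat n p" "B \<in> carrier_mat n q"
    and "C \<in> carrier_mat p m" "D \<in> carrier_mat q m"
  shows "(A @\<^sub>c B) * (C @\<^sub>r D) = A * C + B * D"
proof -
  have "(A @\<^sub>c B) * (C @\<^sub>r D) = four_block_mat (A * C + B * D) (A * 0\<^sub>m p 0 + B * 0\<^sub>m q 0)
      (0\<^sub>m 0 p * C + 0\<^sub>m 0 q * D) (0\<^sub>m 0 p * 0\<^sub>m p 0 + 0\<^sub>m 0 q * 0\<^sub>m q 0)"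
    using assms unfolding append_cols_def append_rows_def
    by (simp add: mult_four_block_mat[where ?nr1.0 = n and ?nr2.0 = 0 and ?n1.0 = p and ?n2.0 = q
          and ?nc1.0 = m and ?nc2.0 = 0])
  also have "\<dots> = A * C + B * D"
    using assms by (intro eq_matI) auto
  finally show ?thesis .
qed

lemma append_cols_mult_four_block:
  fixes A B P Q R S :: "'a :: ring mat"
  assumes "A \<in> carrier_mat n p" "B \<in> carrier_mat n q"
    and "P \<in> carrier_mat p r" "Q \<in> carrier_mat p t" "R \<in> carrier_mat q r" "S \<in> carrier_mat q t"
  shows "(A @\<^sub>c B) * four_block_mat P Q R S = (A * P + B * R) @\<^sub>c (A * Q + B * S)"
proof -
  have "(A @\<^sub>c B) * four_block_mat P Q R S = four_block_mat (A * P + B * R) (A * Q + B * S)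
      (0\<^sub>m 0 p * P + 0\<^sub>m 0 q * R) (0\<^sub>m 0 p * Q + 0\<^sub>m 0 q * S)"
    using assms unfolding append_cols_def
    by (simp add: mult_four_block_mat[where ?nr1.0 = n and ?nr2.0 = 0 and ?n1.0 = p and ?n2.0 = q
          and ?nc1.0 = r and ?nc2.0 = t])
  then show ?thesis
    using assms unfolding append_cols_def by simp
qed

text \<open>
  All three compact formulas have this shape; the lemma removes their block structure.
\<close>

lemma block_bilinear_expand:
  fixes A B C D P Q R S :: "'a :: ring mat"
  assumes "A \<in> carrier_mat n p" "B \<in> carrier_mat n q"
    and "P \<in> carrier_mat p r" "Q \<in> carrier_mat p t" "R \<in> carrier_mat q r" "S \<in> carrier_mat q t"
    and "C \<in> carrier_mat r m" "D \<in> carrier_mat t m"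
  shows "(A @\<^sub>c B) * four_block_mat P Q R S * (C @\<^sub>r D)
    = (A * P + B * R) * C + (A * Q + B * S) * D"
proof -
  have "A * P + B * R \<in> carrier_mat n r" "A * Q + B * S \<in> carrier_mat n t"
    using assms by auto
  then show ?thesis
    using assms by (simp add: append_cols_mult_four_block[where n = n and p = p and q = q
          and r = r and t = t] append_cols_mult_append_rows[where n = n and p = r and q = t
          and m = m])
qed

section \<open>Inverses\<close>

text \<open>
  To evaluate \<open>minv\<close> it is enough to guess a right inverse: for square matrices over a field it is
  two-sided, hence unique.
\<close>

lemma right_inverse_imp_minv:
  fixes A B :: "'a :: field mat"
  assumes A: "A \<in> carrier_mat n n" and B: "B \<in> carrier_mat n n" and AB: "A * B = 1\<^sub>m n"
  shows "invertible_mat A" and "minv A = B"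
proof -
  have BA: "B * A = 1\<^sub>m n"
    by (rule mat_mult_left_right_inverse[OF A B AB])
  show "invertible_mat A"
    using A B AB BA unfolding invertible_mat_def inverts_mat_def by auto
  have "A \<in> Units (ring_mat TYPE('a) n ())"
    using A B AB BA unfolding Units_def by (auto simp: ring_mat_simps)
  then obtain C where C: "mat_inverse A = Some C"
    using mat_inverse(1)[OF A, of "()"] by (cases "mat_inverse A") auto
  then have "C * A = 1\<^sub>m n" "C \<in> carrier_mat n n"
    using mat_inverse(2)[OF A C] by auto
  then have "C = C * (A * B)"
    using AB by simp
  also have "\<dots> = (C * A) * B"
    using A B \<open>C \<in> carrier_mat n n\<close> by simp
  also have "\<dots> = B"
    using B \<open>C * A = 1\<^sub>m n\<close> by simp
  finally show "minv A = B"
    using C by (simp add: minv_def)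
qed

lemma det_nonzero_imp_minv:
  fixes A :: "'a :: field mat"
  assumes A: "A \<in> carrier_mat n n" and "det A \<noteq> 0"
  shows "invertible_mat A" "minv A \<in> carrier_mat n n" "A * minv A = 1\<^sub>m n" "minv A * A = 1\<^sub>m n"
proof -
  obtain B where B: "B \<in> carrier_mat n n" "A * B = 1\<^sub>m n"
    using det_non_zero_imp_unit[OF A \<open>det A \<noteq> 0\<close>, of "()"]
    unfolding Units_def by (auto simp: ring_mat_simps)
  note inv = right_inverse_imp_minv[OF A B]
  show "invertible_mat A" "minv A \<in> carrier_mat n n" "A * minv A = 1\<^sub>m n"
    using inv B by auto
  then show "minv A * A = 1\<^sub>m n"
    using mat_mult_left_right_inverse[OF A] by blast
qed

lemma upper_part_det_nonzero:
  fixes A :: "'a :: field mat"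
  assumes A: "A \<in> carrier_mat k k" and diag: "\<And>i. i < k \<Longrightarrow> A $$ (i, i) \<noteq> 0"
  shows "det (upper_part A) \<noteq> 0"
proof -
  have "upper_triangular (upper_part A)" "upper_part A \<in> carrier_mat k k"
    using A by (auto simp: upper_part_def)
  then have "det (upper_part A) = prod_list (diag_mat (upper_part A))"
    by (rule det_upper_triangular)
  also have "\<dots> \<noteq> 0"
    using A diag by (auto simp: prod_list_zero_iff diag_mat_def upper_part_def)
  finally show ?thesis .
qed

lemma transpose_left_inverse:
  fixes R P :: "'a :: comm_ring_1 mat"
  assumes R: "R \<in> carrier_mat k k" and P: "P \<in> carrier_mat k k" and PR: "P * R = 1\<^sub>m k"
  shows "transpose_mat R * transpose_mat P = 1\<^sub>m k"
  using transpose_mult[OF P R] PR by simp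

text \<open>
  The zero corner makes block elimination elementary: the first block row of the system determines
  the second unknown as \<open>P\<close> times the first right-hand side, and the second block row is then
  solved for the first unknown with \<open>transpose_mat P\<close>.
\<close>

lemma minv_zero_corner_block:
  fixes R N :: "'a :: field mat"
  assumes R: "R \<in> carrier_mat k k" and N: "N \<in> carrier_mat k k" and "det R \<noteq> 0"
  defines "P \<equiv> minv R"
  shows "invertible_mat (four_block_mat (0\<^sub>m k k) R (transpose_mat R) N)"
    and "minv (four_block_mat (0\<^sub>m k k) R (transpose_mat R) N)
      = four_block_mat (- (transpose_mat P * N * P)) (transpose_mat P) P (0\<^sub>m k k)"
proof -
  note inv = det_nonzero_imp_minv[OF R \<open>det R \<noteq> 0\<close>, folded P_def]
  have P: "P \<in> carrier_mat k k" by (rule inv)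
  let ?M = "four_block_mat (0\<^sub>m k k) R (transpose_mat R) N"
  let ?K = "four_block_mat (- (transpose_mat P * N * P)) (transpose_mat P) P (0\<^sub>m k k)"
  have TT: "transpose_mat R * transpose_mat P = 1\<^sub>m k"
    using R P inv(4) by (rule transpose_left_inverse)
  have "transpose_mat R * (transpose_mat P * (N * P))
      = (transpose_mat R * transpose_mat P) * (N * P)"
    using R N P by (simp add: mat_mult_assoc_dim)
  then have cancel: "transpose_mat R * (transpose_mat P * (N * P)) = N * P"
    using N P by (simp add: TT)
  have "?M * ?K = four_block_mat
      (0\<^sub>m k k * - (transpose_mat P * N * P) + R * P) (0\<^sub>m k k * transpose_mat P + R * 0\<^sub>m k k)
      (transpose_mat R * - (transpose_mat P * N * P) + N * P)
      (transpose_mat R * transpose_mat P + N * 0\<^sub>m k k)"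
    using R N P by (intro mult_four_block_mat) auto
  also have "\<dots> = 1\<^sub>m (k + k)"
  proof -
    have "transpose_mat R * - (transpose_mat P * N * P) + N * P = - (N * P) + N * P"
      using R N P by (simp add: mat_mult_assoc_dim cancel)
    also have "\<dots> = 0\<^sub>m k k"
      using N P by (intro eq_matI) auto
    finally have lower: "transpose_mat R * - (transpose_mat P * N * P) + N * P = 0\<^sub>m k k" .
    have neg0: "- 0\<^sub>m k k = (0\<^sub>m k k :: 'a mat)"
      by (intro eq_matI) auto
    show ?thesis
      unfolding lower using R N P inv(3) TT by (simp add: neg0)
  qed
  finally have MK: "?M * ?K = 1\<^sub>m (k + k)" .
  have c: "?M \<in> carrier_mat (k + k) (k + k)" "?K \<in> carrier_mat (k + k) (k + k)"
    using R N P by auto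
  show "invertible_mat ?M" "minv ?M = ?K"
    using right_inverse_imp_minv[OF c MK] by auto
qed

section \<open>The compact formulas as sums of monomials\<close>

lemma two_block_formula_expand:
  fixes V W K P :: "'a :: ring mat"
  assumes "V \<in> carrier_mat d k" "W \<in> carrier_mat d k" "K \<in> carrier_mat k k" "P \<in> carrier_mat k k"
  shows "(V @\<^sub>c W) * four_block_mat K (transpose_mat P) P (0\<^sub>m k k)
      * (transpose_mat V @\<^sub>r transpose_mat W)
    = V * K * transpose_mat V + W * P * transpose_mat V + V * transpose_mat P * transpose_mat W"
  using assms
  by (subst block_bilinear_expand[where n = d and p = k and q = k and r = k and t = k and m = d])
    (auto simp: mat_ring_simps)

text \<open>
  On the left, the factor \<open>G\<close> meets only the blocks \<open>- P\<close> and \<open>- transpose_mat P\<close>, and there it is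
  paired with \<open>V\<close>, never with \<open>S\<close> or itself. This is what replacing \<open>S\<close> by \<open>S - G\<close> in the
  off-diagonal terms of the two-block formula does; the term with \<open>K\<close> involves \<open>V\<close> alone.
\<close>

lemma three_block_formula_eq_two_block:
  fixes V S G K P :: "'a :: ring mat"
  assumes V: "V \<in> carrier_mat d k" and S: "S \<in> carrier_mat d k" and G: "G \<in> carrier_mat d k"
    and K: "K \<in> carrier_mat k k" and P: "P \<in> carrier_mat k k"
  defines "B \<equiv> four_block_mat K (transpose_mat P) P (0\<^sub>m k k)"
  shows "(V @\<^sub>c S @\<^sub>c G)
      * four_block_mat B (- transpose_mat P @\<^sub>r 0\<^sub>m k k) (- P @\<^sub>c 0\<^sub>m k k) (0\<^sub>m k k)
      * (transpose_mat V @\<^sub>r transpose_mat S @\<^sub>r transpose_mat G)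
    = (V @\<^sub>c (S - G)) * B * (transpose_mat V @\<^sub>r transpose_mat (S - G))"
proof -
  let ?Q = "- transpose_mat P @\<^sub>r 0\<^sub>m k k" and ?L = "- P @\<^sub>c 0\<^sub>m k k"
  let ?VS = "V @\<^sub>c S" and ?VST = "transpose_mat V @\<^sub>r transpose_mat S"
  have B: "B \<in> carrier_mat (k + k) (k + k)" and Q: "?Q \<in> carrier_mat (k + k) k"
    and L: "?L \<in> carrier_mat k (k + k)" and VS: "?VS \<in> carrier_mat d (k + k)"
    and VST: "?VST \<in> carrier_mat (k + k) d"
    using V S K P unfolding B_def by auto
  \<comment> \<open>The middle matrix has blocks of sizes \<open>k + k\<close> and \<open>k\<close>, so the outer factors are bracketed to match.\<close>
  have "(V @\<^sub>c S @\<^sub>c G) * four_block_mat B ?Q ?L (0\<^sub>m k k)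
        * (transpose_mat V @\<^sub>r transpose_mat S @\<^sub>r transpose_mat G)
      = (?VS @\<^sub>c G) * four_block_mat B ?Q ?L (0\<^sub>m k k) * (?VST @\<^sub>r transpose_mat G)"
    using V S G by (simp add: append_cols_assoc[where n = d and p = k and q = k and r = k]
        append_rows_assoc[where n = d and p = k and q = k and r = k])
  also have "\<dots> = (?VS * B + G * ?L) * ?VST + (?VS * ?Q + G * 0\<^sub>m k k) * transpose_mat G"
    using VS G B Q L VST
    by (intro block_bilinear_expand[where n = d and p = "k + k" and q = k and r = "k + k"
          and t = k and m = d]) auto
  also have "\<dots> = ?VS * B * ?VST + G * (?L * ?VST) + ?VS * ?Q * transpose_mat G"
    using VS G B Q L VST by (simp add: mat_ring_simps carrier_matD)
  also have "?VS * B * ?VST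
      = V * K * transpose_mat V + S * P * transpose_mat V + V * transpose_mat P * transpose_mat S"
    unfolding B_def by (rule two_block_formula_expand[OF V S K P])
  also have "?L * ?VST = - P * transpose_mat V + 0\<^sub>m k k * transpose_mat S"
    using P V S by (intro append_cols_mult_append_rows) auto
  also have "?VS * ?Q = V * - transpose_mat P + S * 0\<^sub>m k k"
    using P V S by (intro append_cols_mult_append_rows) auto
  finally have "(V @\<^sub>c S @\<^sub>c G) * four_block_mat B ?Q ?L (0\<^sub>m k k)
        * (transpose_mat V @\<^sub>r transpose_mat S @\<^sub>r transpose_mat G)
      = V * K * transpose_mat V + S * P * transpose_mat V + V * transpose_mat P * transpose_mat S
        + G * (- P * transpose_mat V + 0\<^sub>m k k * transpose_mat S)
        + (V * - transpose_mat P + S * 0\<^sub>m k k) * transpose_mat G" .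
  also have "\<dots> = V * K * transpose_mat V + (S - G) * P * transpose_mat V
      + V * transpose_mat P * transpose_mat (S - G)"
  proof -
    \<comment> \<open>Name the monomials so that the comparison takes place in the additive group alone.\<close>
    define X1 where "X1 = V * (K * transpose_mat V)"
    define X2 where "X2 = S * (P * transpose_mat V)"
    define X3 where "X3 = V * (transpose_mat P * transpose_mat S)"
    define X4 where "X4 = G * (P * transpose_mat V)"
    define X5 where "X5 = V * (transpose_mat P * transpose_mat G)"
    have "X1 \<in> carrier_mat d d" "X2 \<in> carrier_mat d d" "X3 \<in> carrier_mat d d"
      "X4 \<in> carrier_mat d d" "X5 \<in> carrier_mat d d"
      using V S G K P unfolding X1_def X2_def X3_def X4_def X5_def by auto
    then have "X1 + X2 + X3 + - X4 + - X5 = X1 + (X2 - X4) + (X3 - X5)"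
      by (intro eq_matI) auto
    then show ?thesis
      using V S G K P unfolding X1_def X2_def X3_def X4_def X5_def
      by (simp add: mat_ring_simps transpose_minus[OF S G])
  qed
  also have "\<dots> = (V @\<^sub>c (S - G)) * B * (transpose_mat V @\<^sub>r transpose_mat (S - G))"
    unfolding B_def using S G by (intro two_block_formula_expand[OF V _ K P, symmetric]) auto
  finally show ?thesis .
qed

text \<open>
  In the summand with \<open>R\<close> the right factor \<open>P\<close> cancels against \<open>R\<close> and leaves
  \<open>transpose_mat P\<close>; in the summand with \<open>transpose_mat R\<close> it is the left factor that cancels,
  and \<open>P\<close> is left.
\<close>

lemma congruence_cancels_triangular_parts:
  fixes R P Q :: "'a :: comm_ring_1 mat"
  assumes R: "R \<in> carrier_mat k k" and P: "P \<in> carrier_mat k k" and Q: "Q \<in> carrier_mat k k"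
    and RP: "R * P = 1\<^sub>m k"
  shows "- (transpose_mat P * (R + transpose_mat R - Q) * P)
    = transpose_mat P * Q * P - transpose_mat P - P"
proof -
  have PR: "transpose_mat P * transpose_mat R = 1\<^sub>m k"
    using P R RP by (rule transpose_left_inverse)
  have "transpose_mat P * (transpose_mat R * P) = (transpose_mat P * transpose_mat R) * P"
    using R P by (simp add: mat_mult_assoc_dim)
  then have "transpose_mat P * (transpose_mat R * P) = P"
    using P by (simp add: PR)
  then have "transpose_mat P * (R + transpose_mat R - Q) * P
      = transpose_mat P + P - transpose_mat P * Q * P"
    using R P Q RP by (simp add: mat_ring_simps)
  moreover have "- (transpose_mat P + P - transpose_mat P * Q * P)
      = transpose_mat P * Q * P - transpose_mat P - P"
    using P Q by (intro eq_matI) auto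
  ultimately show ?thesis by simp
qed

text \<open>
  The terms \<open>- transpose_mat P\<close> and \<open>- P\<close> supplied by
  \<open>congruence_cancels_triangular_parts\<close> in the upper left block remove the two monomials
  \<open>S * P * transpose_mat S\<close> and \<open>S * transpose_mat P * transpose_mat S\<close> that come from the
  occurrences of \<open>S\<close> in \<open>S - G\<close> (\<open>X2\<close> and \<open>X3\<close> in the proof). The surviving \<open>G\<close> terms have
  negative sign, as in the BFGS matrix.
\<close>

lemma two_block_formula_eq_BFGS_form:
  fixes S G R P Q :: "'a :: comm_ring_1 mat"
  assumes S: "S \<in> carrier_mat d k" and G: "G \<in> carrier_mat d k"
    and R: "R \<in> carrier_mat k k" and P: "P \<in> carrier_mat k k" and Q: "Q \<in> carrier_mat k k"
    and RP: "R * P = 1\<^sub>m k"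
  shows "(S @\<^sub>c (S - G))
      * four_block_mat (- (transpose_mat P * (R + transpose_mat R - Q) * P)) (transpose_mat P) P (0\<^sub>m k k)
      * (transpose_mat S @\<^sub>r transpose_mat (S - G))
    = (S @\<^sub>c G)
      * four_block_mat (transpose_mat P * Q * P) (- transpose_mat P) (- P) (0\<^sub>m k k)
      * (transpose_mat S @\<^sub>r transpose_mat G)"
proof -
  let ?C = "transpose_mat P * Q * P"
  define X1 where "X1 = S * (?C * transpose_mat S)"
  define X2 where "X2 = S * (P * transpose_mat S)"
  define X3 where "X3 = S * (transpose_mat P * transpose_mat S)"
  define X4 where "X4 = G * (P * transpose_mat S)"
  define X5 where "X5 = S * (transpose_mat P * transpose_mat G)"
  have X: "X1 \<in> carrier_mat d d" "X2 \<in> carrier_mat d d" "X3 \<in> carrier_mat d d"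
    "X4 \<in> carrier_mat d d" "X5 \<in> carrier_mat d d"
    using S G P Q unfolding X1_def X2_def X3_def X4_def X5_def by auto
  have "(S @\<^sub>c (S - G)) * four_block_mat (?C - transpose_mat P - P) (transpose_mat P) P (0\<^sub>m k k)
      * (transpose_mat S @\<^sub>r transpose_mat (S - G))
    = S * (?C - transpose_mat P - P) * transpose_mat S + (S - G) * P * transpose_mat S
      + S * transpose_mat P * transpose_mat (S - G)"
    using S G P Q by (intro two_block_formula_expand) auto
  also have "\<dots> = (X1 - X3 - X2) + (X2 - X4) + (X3 - X5)"
    using S G P Q unfolding X1_def X2_def X3_def X4_def X5_def
    by (simp add: mat_ring_simps transpose_minus[OF S G])
  also have "\<dots> = (X1 + - X4) + - X5"
    using X by (intro eq_matI) auto
  also have "\<dots> = (S * ?C + G * - P) * transpose_mat S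
      + (S * - transpose_mat P + G * 0\<^sub>m k k) * transpose_mat G"
    using S G P Q unfolding X1_def X2_def X3_def X4_def X5_def
    by (simp add: mat_ring_simps)
  also have "\<dots> = (S @\<^sub>c G) * four_block_mat ?C (- transpose_mat P) (- P) (0\<^sub>m k k)
      * (transpose_mat S @\<^sub>r transpose_mat G)"
    using S G P Q by (intro block_bilinear_expand[symmetric]) auto
  finally show ?thesis
    by (simp add: congruence_cancels_triangular_parts[OF R P Q RP])
qed

section \<open>The quasi-Newton matrices\<close>

lemma cols_mat_carrier [simp, intro]: "cols_mat d k x \<in> carrier_mat d k"
  unfolding cols_mat_def by (intro carrier_matI) auto

lemma R_mat_carrier [simp, intro]: "R_mat d k x y \<in> carrier_mat k k"
  unfolding R_mat_def upper_part_def
  by (intro carrier_matI) (simp_all add: carrier_matD[OF cols_mat_carrier])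

lemma det_R_mat_nonzero:
  assumes "\<And>i. i < k \<Longrightarrow> x i \<in> carrier_vec d" "\<And>i. i < k \<Longrightarrow> y i \<in> carrier_vec d"
    and "\<And>i. i < k \<Longrightarrow> x i \<bullet> y i \<noteq> 0"
  shows "det (R_mat d k x y) \<noteq> 0"
proof -
  let ?X = "cols_mat d k x" and ?Y = "cols_mat d k y"
  have "(transpose_mat ?X * ?Y) $$ (i, i) = x i \<bullet> y i" if "i < k" for i
    using that assms(1,2)[OF that] by (simp add: cols_mat_def)
  moreover have "transpose_mat ?X * ?Y \<in> carrier_mat k k"
    by (rule mult_carrier_mat[of _ _ d]) auto
  ultimately show ?thesis
    unfolding R_mat_def using assms(3) by (intro upper_part_det_nonzero) auto
qed

theorem corollary3p4:
  fixes d k :: nat and H0 H :: "real mat" and s y v :: "nat \<Rightarrow> real vec"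
  assumes "d \<ge> 1" and "k \<ge> 1"
    and "H0 \<in> carrier_mat d d" and "transpose_mat H0 = H0"
    and "\<And>i. i < k \<Longrightarrow> s i \<in> carrier_vec d"
    and "\<And>i. i < k \<Longrightarrow> y i \<in> carrier_vec d"
    and "\<And>i. i < k \<Longrightarrow> v i \<in> carrier_vec d"
    and "\<And>i. i < k \<Longrightarrow> v i \<bullet> y i \<noteq> 0"
    and "H = H_compact1 d k H0 s y v \<or> H = H_compact2 d k H0 s y v"
  shows "invertible_mat (R_mat d k v y) \<and> invertible_mat (M_mat d k H0 s y v) \<and>
    H_compact1 d k H0 s y v = H_compact2 d k H0 s y v \<and>
    (cols_mat d k v = cols_mat d k s \<longrightarrow>
      invertible_mat (R_mat d k s y) \<and> H = H_BFGS d k H0 s y)"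
proof -
  let ?S = "cols_mat d k s" and ?Y = "cols_mat d k y" and ?V = "cols_mat d k v"
  let ?R = "R_mat d k s y" and ?RV = "R_mat d k v y"
  let ?P = "minv ?RV" and ?G = "H0 * ?Y"
  let ?Q = "D_mat k s y + transpose_mat ?Y * H0 * ?Y"
  let ?N = "?R + transpose_mat ?R - ?Q"
  have H0: "H0 \<in> carrier_mat d d" by fact
  have G: "?G \<in> carrier_mat d k"
    using H0 by auto
  have GT: "transpose_mat ?G = transpose_mat ?Y * H0"
    using transpose_mult[OF H0 cols_mat_carrier] assms(4) by simp
  have "transpose_mat ?Y * H0 * ?Y \<in> carrier_mat k k"
    using H0 by (intro mult_carrier_mat[of _ _ d]) auto
  then have Q: "?Q \<in> carrier_mat k k"
    by (simp add: D_mat_def)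
  then have N: "?N \<in> carrier_mat k k"
    by (rule minus_carrier_mat)
  have det: "det ?RV \<noteq> 0"
    using assms(6-8) by (intro det_R_mat_nonzero[of k v]) auto
  note inv = det_nonzero_imp_minv[OF R_mat_carrier det]
  have M: "M_mat d k H0 s y v = four_block_mat (0\<^sub>m k k) ?RV (transpose_mat ?RV) ?N"
    by (simp add: M_mat_def Let_def)
  have invM: "invertible_mat (M_mat d k H0 s y v)"
    unfolding M by (rule minv_zero_corner_block(1)[OF R_mat_carrier N det])
  have minvM: "minv (M_mat d k H0 s y v)
      = four_block_mat (- (transpose_mat ?P * ?N * ?P)) (transpose_mat ?P) ?P (0\<^sub>m k k)"
    unfolding M by (rule minv_zero_corner_block(2)[OF R_mat_carrier N det])
  have K: "- (transpose_mat ?P * ?N * ?P) \<in> carrier_mat k k"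
    using N inv(2) by auto
  have eq: "H_compact1 d k H0 s y v = H_compact2 d k H0 s y v"
    unfolding H_compact1_def H_compact2_def Let_def minvM
    using three_block_formula_eq_two_block[OF cols_mat_carrier[of d k v] cols_mat_carrier[of d k s]
        G K inv(2), unfolded GT]
    by (simp only:)
  have bfgs: "invertible_mat ?R \<and> H = H_BFGS d k H0 s y" if VS: "?V = ?S"
  proof -
    have RR: "?RV = ?R"
      by (simp add: R_mat_def VS)
    have "H_compact1 d k H0 s y v = H_BFGS d k H0 s y"
      unfolding H_compact1_def H_BFGS_def Let_def minvM VS RR
      using two_block_formula_eq_BFGS_form[OF cols_mat_carrier[of d k s] G R_mat_carrier
          inv(2)[unfolded RR] Q inv(3)[unfolded RR], unfolded GT]
      by (simp only:)
    then show ?thesis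
      using inv(1) RR eq assms(9) by auto
  qed
  show ?thesis
    using inv(1) invM eq bfgs by blast
qed

end
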